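(* Let $\mathbb{K}$ be an algebraically closed field, $V$ a $\mathbb{K}$-vector space of finite positive dimension, and $\Phi=(A;\{E_i\}_{i=0}^d;A^*;\{E_i^*\}_{i=0}^d)$ a TD system on $V$ of diameter $d\geq 1$ that has $q$-Racah type, with fixed associated scalars $q,a,b$. Let $K,B,\psi,\mathcal{M}$ be the associated elements of $\mathrm{End}(V)$ defined in the context. Then $\mathcal{M}$ is equal to each of $$(I-a^{-1}q\psi)^{-1}K,\qquad K(I-a^{-1}q^{-1}\psi)^{-1},\qquad (I-aq\psi)^{-1}B,\qquad B(I-aq^{-1}\psi)^{-1}.$$
   Context: TD pair: an ordered pair of linear maps $A,A^*:V\to V$ such that (i) each is diagonalizable; (ii) there is an ordering $\{V_i\}_{i=0}^d$ of the eigenspaces of $A$ with $A^*V_i\subseteq V_{i-1}+V_i+V_{i+1}$ for $0\le i\le d$ ($V_{-1}=V_{d+1}=0$); (iii) there is an ordering $\{V_i^*\}_{i=0}^\delta$ of the eigenspaces of $A^*$ with $AV_i^*\subseteq V_{i-1}^*+V_i^*+V_{i+1}^*$ for $0\le i\le\delta$ ($V^*_{-1}=V^*_{\delta+1}=0$); (iv) no subspace $W$ with $0\ne W\ne V$ satisfies $AW\subseteq W$ and $A^*W\subseteq W$. It is known that $d=\delta$; $d$ is called the diameter. Orderings as in (ii), (iii) are called standard. The primitive idempotent of $A$ for an eigenspace $V_i$ is the projection of $V$ onto $V_i$ that vanishes on the other eigenspaces (similarly for $A^*$). TD system: $(A;\{E_i\}_{i=0}^d;A^*;\{E_i^*\}_{i=0}^d)$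 where $A,A^*$ is a TD pair and $\{E_i\}$, $\{E_i^*\}$ are the primitive idempotents of $A$, $A^*$, in orders for which the corresponding eigenspace orderings $\{E_iV\}$, $\{E_i^*V\}$ are standard. Let $\theta_i$ (resp. $\theta_i^*$) be the eigenvalue of $A$ on $E_iV$ (resp. of $A^*$ on $E_i^*V$). $\Phi$ has $q$-Racah type if there are nonzero $q,a,b\in\mathbb{K}$ with $q^4\ne1$ and $\theta_i=aq^{d-2i}+a^{-1}q^{2i-d}$, $\theta_i^*=bq^{d-2i}+b^{-1}q^{2i-d}$ for $0\le i\le d$. (Distinctness of eigenvalues forces $q^{2i}\neq1$ for $1\le i\le d$, and $a^2\ne q^{2d-2},q^{2d-4},\dots,q^{2-2d}$; in particular $a^2\neq 1$.) Split decompositions: $U_i=(E_0^*V+\cdots+E_i^*V)\cap(E_iV+\cdots+E_dV)$ and $U_i^\Downarrow=(E_0^*V+\cdots+E_i^*V)\cap(E_0V+\cdots+E_{d-i}V)$ for $0\le i\le d$. It is known that $V=\bigoplus_i U_i=\bigoplus_i U_i^\Downarrow$ with all summands nonzero. $K,B\in\mathrm{End}(V)$ are the linear maps acting on $U_i$, respectively $U_i^\Downarrow$, as the scalar $q^{d-2i}$ ($0\le i\le d$). $\psi\in\mathrm{End}(V)$: $\psi=(I-BK^{-1})\,\bigl(q(aI-a^{-1}BK^{-1})\bigr)^{-1}$ (the inverse is known to exist; it is known that $\psi$ also equals $q(I-K^{-1}B)(aI-a^{-1}K^{-1}B)^{-1}$, $(I-KB^{-1})(q(a^{-1}I-aKB^{-1}))^{-1}$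 and $q(I-B^{-1}K)(a^{-1}I-aB^{-1}K)^{-1}$). It is known that $\psi^{d+1}=0$, so $I-x\psi$ is invertible for every $x\in\mathbb{K}$. $\mathcal{M}\in\mathrm{End}(V)$: $\mathcal{M}=\dfrac{aK-a^{-1}B}{a-a^{-1}}$. *)

theory Defs
  imports
    "HOL-Computational_Algebra.Polynomial"
    "HOL-Library.Set_Algebras"
begin

text \<open>
  The vector space V is the whole type \<open>'b\<close>, with scalar multiplication \<open>scale\<close>. An element
  of End(V) is a function \<open>f :: 'b \<Rightarrow> 'b\<close> with \<open>Vector_Spaces.linear scale scale f\<close>; the product
  in End(V) is composition and the inverse of an invertible element is \<open>inv\<close>. A sum of subspaces
  is the elementwise sum of sets from \<open>HOL-Library.Set_Algebras\<close>.
\<close>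

locale nonzero_fd_vector_space = finite_dimensional_vector_space +
  assumes dim_pos: "dim UNIV > 0"
begin

definition eigenspace :: "('b \<Rightarrow> 'b) \<Rightarrow> 'a \<Rightarrow> 'b set" where
  "eigenspace f t = {v. f v = t *s v}"

definition eigenspaces :: "('b \<Rightarrow> 'b) \<Rightarrow> 'b set set" where
  "eigenspaces f = {W. W \<noteq> {0} \<and> (\<exists>t. W = eigenspace f t)}"

definition diagonalizable :: "('b \<Rightarrow> 'b) \<Rightarrow> bool" where
  "diagonalizable f \<longleftrightarrow>
     (\<exists>S. independent S \<and> span S = UNIV \<and> (\<forall>v\<in>S. \<exists>t. f v = t *s v))"

definition standard_ordering :: "('b \<Rightarrow> 'b) \<Rightarrow> ('b \<Rightarrow> 'b) \<Rightarrow> nat \<Rightarrow> (nat \<Rightarrow> 'b set) \<Rightarrow> bool" where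
  "standard_ordering f g d W \<longleftrightarrow>
     bij_betw W {..d} (eigenspaces f) \<and>
     (\<forall>i\<le>d. g ` W i \<subseteq>
        (if i = 0 then {0} else W (i - 1)) + W i + (if i = d then {0} else W (i + 1)))"

definition TD_pair :: "('b \<Rightarrow> 'b) \<Rightarrow> ('b \<Rightarrow> 'b) \<Rightarrow> bool" where
  "TD_pair A As \<longleftrightarrow>
     Vector_Spaces.linear scale scale A \<and> Vector_Spaces.linear scale scale As \<and>
     diagonalizable A \<and> diagonalizable As \<and>
     (\<exists>d W. standard_ordering A As d W) \<and>
     (\<exists>\<delta> Ws. standard_ordering As A \<delta> Ws) \<and>
     \<not> (\<exists>W. subspace W \<and> W \<noteq> {0} \<and> W \<noteq> UNIV \<and> A ` W \<subseteq> W \<and> As ` W \<subseteq> W)"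

definition primitive_idempotent :: "('b \<Rightarrow> 'b) \<Rightarrow> 'b set \<Rightarrow> ('b \<Rightarrow> 'b) \<Rightarrow> bool" where
  "primitive_idempotent f W P \<longleftrightarrow>
     W \<in> eigenspaces f \<and> Vector_Spaces.linear scale scale P \<and> range P = W \<and> (\<forall>v\<in>W. P v = v) \<and>
     (\<forall>W'\<in>eigenspaces f - {W}. \<forall>v\<in>W'. P v = 0)"

text \<open>The families \<open>E\<close>, \<open>Es\<close> are only relevant at the indices \<open>0, \<dots>, d\<close>; \<open>range (E i)\<close> is \<open>E\<^sub>i V\<close>.\<close>

definition TD_system ::
  "('b \<Rightarrow> 'b) \<Rightarrow> (nat \<Rightarrow> 'b \<Rightarrow> 'b) \<Rightarrow> ('b \<Rightarrow> 'b) \<Rightarrow> (nat \<Rightarrow> 'b \<Rightarrow> 'b) \<Rightarrow> nat \<Rightarrow> bool" where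
  "TD_system A E As Es d \<longleftrightarrow>
     TD_pair A As \<and>
     (\<forall>i\<le>d. primitive_idempotent A (range (E i)) (E i)) \<and>
     (\<forall>i\<le>d. primitive_idempotent As (range (Es i)) (Es i)) \<and>
     standard_ordering A As d (\<lambda>i. range (E i)) \<and>
     standard_ordering As A d (\<lambda>i. range (Es i))"

text \<open>
  The scalar \<open>\<theta>\<^sub>i\<close> is the one with \<open>range (E i) = eigenspace A \<theta>\<^sub>i\<close>; it is unique since \<open>range (E i)\<close> is
  nonzero in a TD system.
\<close>

definition q_Racah_type ::
  "('b \<Rightarrow> 'b) \<Rightarrow> (nat \<Rightarrow> 'b \<Rightarrow> 'b) \<Rightarrow> ('b \<Rightarrow> 'b) \<Rightarrow> (nat \<Rightarrow> 'b \<Rightarrow> 'b) \<Rightarrow> nat \<Rightarrow>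
     'a \<Rightarrow> 'a \<Rightarrow> 'a \<Rightarrow> bool" where
  "q_Racah_type A E As Es d q a b \<longleftrightarrow>
     q \<noteq> 0 \<and> a \<noteq> 0 \<and> b \<noteq> 0 \<and> q ^ 4 \<noteq> 1 \<and>
     (\<forall>i\<le>d. range (E i) = eigenspace A
        (a * q powi (int d - 2 * int i) + inverse a * q powi (2 * int i - int d))) \<and>
     (\<forall>i\<le>d. range (Es i) = eigenspace As
        (b * q powi (int d - 2 * int i) + inverse b * q powi (2 * int i - int d)))"

definition split_U ::
  "(nat \<Rightarrow> 'b \<Rightarrow> 'b) \<Rightarrow> (nat \<Rightarrow> 'b \<Rightarrow> 'b) \<Rightarrow> nat \<Rightarrow> nat \<Rightarrow> 'b set" where
  "split_U E Es d i = (\<Sum>j\<in>{0..i}. range (Es j)) \<inter> (\<Sum>j\<in>{i..d}. range (E j))"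

definition split_U_down ::
  "(nat \<Rightarrow> 'b \<Rightarrow> 'b) \<Rightarrow> (nat \<Rightarrow> 'b \<Rightarrow> 'b) \<Rightarrow> nat \<Rightarrow> nat \<Rightarrow> 'b set" where
  "split_U_down E Es d i = (\<Sum>j\<in>{0..i}. range (Es j)) \<inter> (\<Sum>j\<in>{0..d - i}. range (E j))"

text \<open>
  The definite descriptions below are meaningful because V is the direct sum of the \<open>split_U E Es d i\<close>,
  and also of the \<open>split_U_down E Es d i\<close>, for \<open>i \<le> d\<close>.
\<close>

definition K_map ::
  "(nat \<Rightarrow> 'b \<Rightarrow> 'b) \<Rightarrow> (nat \<Rightarrow> 'b \<Rightarrow> 'b) \<Rightarrow> nat \<Rightarrow> 'a \<Rightarrow> 'b \<Rightarrow> 'b" where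
  "K_map E Es d q = (THE f. Vector_Spaces.linear scale scale f \<and>
     (\<forall>i\<le>d. \<forall>v\<in>split_U E Es d i. f v = q powi (int d - 2 * int i) *s v))"

definition B_map ::
  "(nat \<Rightarrow> 'b \<Rightarrow> 'b) \<Rightarrow> (nat \<Rightarrow> 'b \<Rightarrow> 'b) \<Rightarrow> nat \<Rightarrow> 'a \<Rightarrow> 'b \<Rightarrow> 'b" where
  "B_map E Es d q = (THE f. Vector_Spaces.linear scale scale f \<and>
     (\<forall>i\<le>d. \<forall>v\<in>split_U_down E Es d i. f v = q powi (int d - 2 * int i) *s v))"

definition psi_map :: "'a \<Rightarrow> 'a \<Rightarrow> ('b \<Rightarrow> 'b) \<Rightarrow> ('b \<Rightarrow> 'b) \<Rightarrow> 'b \<Rightarrow> 'b" where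
  "psi_map q a K B =
     (\<lambda>v. v - (B \<circ> inv K) v) \<circ> inv (\<lambda>v. q *s (a *s v - inverse a *s (B \<circ> inv K) v))"

definition M_map :: "'a \<Rightarrow> ('b \<Rightarrow> 'b) \<Rightarrow> ('b \<Rightarrow> 'b) \<Rightarrow> 'b \<Rightarrow> 'b" where
  "M_map a K B = (\<lambda>v. inverse (a - inverse a) *s (a *s K v - inverse a *s B v))"

end

end

theory Submission
  imports Defs
begin

text \<open>
  Write \<open>N = a K - a\<^sup>-\<^sup>1 B\<close>, a multiple of \<open>M\<close>. It is invertible, because \<open>K\<close> and \<open>B\<close> are triangular with the
  same diagonal with respect to the flag \<open>E\<^sup>*\<^sub>0V + \<dots> + E\<^sup>*\<^sub>iV\<close>, and \<open>\<psi> N = q\<^sup>-\<^sup>1 (K - B)\<close>. Hence the first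
  and third formulas are linear algebra, while the second and fourth are equivalent to the vanishing
  of \<open>Q = (1 - p) a K\<^sup>2 - (a\<^sup>-\<^sup>1 - p a) K B - (a - p a\<^sup>-\<^sup>1) B K + (1 - p) a\<^sup>-\<^sup>1 B\<^sup>2\<close>, where \<open>p = q\<^sup>-\<^sup>2\<close>.
  Each of \<open>A\<close>, \<open>A\<^sup>*\<close> commutes with \<open>K\<close> and \<open>B\<close> up to a scalar factor and terms in \<open>K\<^sup>2\<close>, \<open>B\<^sup>2\<close> and \<open>I\<close>,
  and commutes with \<open>Q\<close> up to a scalar factor and terms in \<open>K Q\<close>, \<open>Q K\<close>, \<open>B Q\<close>, \<open>Q B\<close>. Therefore the
  largest \<open>K\<close>, \<open>B\<close>-invariant subspace of the kernel of \<open>Q\<close> is invariant under \<open>A\<close> and \<open>A\<^sup>*\<close>. It contains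
  \<open>E\<^sup>*\<^sub>0V\<close>, on which \<open>K\<close> and \<open>B\<close> are the same scalar, so by irreducibility it is \<open>V\<close>.
\<close>

section \<open>The split decomposition\<close>

locale tridiagonal_decomposition = finite_dimensional_vector_space +
  fixes f g :: "'b \<Rightarrow> 'b" and E :: "nat \<Rightarrow> 'b \<Rightarrow> 'b" and \<theta> :: "nat \<Rightarrow> 'a" and d :: nat
  assumes linear_f: "Vector_Spaces.linear scale scale f"
    and linear_g: "Vector_Spaces.linear scale scale g"
    and linear_E: "\<And>i. i \<le> d \<Longrightarrow> Vector_Spaces.linear scale scale (E i)"
    and sum_E: "\<And>v. (\<Sum>i\<le>d. E i v) = v"
    and E_E: "\<And>i j v. i \<le> d \<Longrightarrow> j \<le> d \<Longrightarrow> E i (E j v) = (if i = j then E j v else 0)"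
    and f_E: "\<And>i v. i \<le> d \<Longrightarrow> f (E i v) = \<theta> i *s E i v"
    and E_g_E: "\<And>i j v. i \<le> d \<Longrightarrow> j \<le> d \<Longrightarrow> i + 1 < j \<or> j + 1 < i \<Longrightarrow> E j (g (E i v)) = 0"
begin

sublocale f: Vector_Spaces.linear scale scale f by (rule linear_f)
sublocale g: Vector_Spaces.linear scale scale g by (rule linear_g)

lemma E_0 [simp]: "i \<le> d \<Longrightarrow> E i 0 = 0"
  and E_add: "i \<le> d \<Longrightarrow> E i (v + w) = E i v + E i w"
  and E_diff: "i \<le> d \<Longrightarrow> E i (v - w) = E i v - E i w"
  and E_scale: "i \<le> d \<Longrightarrow> E i (c *s v) = c *s E i v"
  and E_sum: "i \<le> d \<Longrightarrow> E i (sum u S) = (\<Sum>x\<in>S. E i (u x))"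
  by (auto dest: linear_E simp: linear_iff_module_hom module_hom.zero module_hom.add module_hom.diff
      module_hom.scale module_hom.sum)

lemma E_f:
  assumes "i \<le> d"
  shows "E i (f v) = \<theta> i *s E i v"
proof -
  have "E i (f v) = E i (f (\<Sum>j\<le>d. E j v))"
    by (simp add: sum_E)
  also have "\<dots> = (\<Sum>j\<le>d. \<theta> j *s E i (E j v))"
    using assms by (simp add: f.sum f_E E_sum E_scale)
  also have "\<dots> = (\<Sum>j\<le>d. if j = i then \<theta> i *s E i v else 0)"
    using assms by (intro sum.cong) (auto simp: E_E)
  finally show ?thesis
    using assms by simp
qed

lemma E_g_eq_0:
  assumes "j \<le> d" and "\<And>k. k \<le> d \<Longrightarrow> k \<le> j + 1 \<Longrightarrow> j \<le> k + 1 \<Longrightarrow> E k v = 0"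
  shows "E j (g v) = 0"
proof -
  have "E j (g (E k v)) = 0" if "k \<le> d" for k
  proof (cases "k \<le> j + 1 \<and> j \<le> k + 1")
    case True
    then have "E k v = 0"
      using assms(2) that by blast
    then show ?thesis
      using assms(1) by simp
  next
    case False
    then show ?thesis
      using assms(1) that by (intro E_g_E) auto
  qed
  then have "E j (g (\<Sum>k\<le>d. E k v)) = 0"
    using assms(1) by (simp add: g.sum E_sum)
  then show ?thesis
    by (simp add: sum_E)
qed

lemma eq_0_if_E_eq_0:
  assumes "\<And>i. i \<le> d \<Longrightarrow> E i v = 0"
  shows "v = 0"
  using sum_E[of v] assms by simp

text \<open>Turns membership in the sums that define the split decompositions into the vanishing of
  components.\<close>

lemma sum_range_E:
  assumes "S \<subseteq> {..d}"
  shows "(\<Sum>j\<in>S. range (E j)) = {v. \<forall>k\<le>d. k \<notin> S \<longrightarrow> E k v = 0}"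
proof -
  have fin: "finite S"
    using assms finite_subset by blast
  have "E k (sum s S) = 0" if "k \<le> d" "k \<notin> S" "\<forall>i\<in>S. s i \<in> range (E i)" for k s
  proof -
    have "E k (s i) = 0" if "i \<in> S" for i
    proof -
      obtain w where "s i = E i w"
        using bspec[OF \<open>\<forall>i\<in>S. s i \<in> range (E i)\<close> \<open>i \<in> S\<close>] by (elim imageE)
      moreover have "i \<le> d" "k \<noteq> i"
        using that \<open>k \<notin> S\<close> assms by auto
      ultimately show ?thesis
        using \<open>k \<le> d\<close> by (simp add: E_E)
    qed
    then show ?thesis
      using \<open>k \<le> d\<close> by (simp add: E_sum)
  qed
  moreover have "\<exists>s. v = sum s S \<and> (\<forall>i\<in>S. s i \<in> range (E i))"
    if "\<forall>k\<le>d. k \<notin> S \<longrightarrow> E k v = 0" for v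
  proof (intro exI conjI ballI)
    have "(\<Sum>i\<le>d. E i v) = (\<Sum>i\<in>S. E i v)"
      using assms that by (intro sum.mono_neutral_right) auto
    then show "v = (\<Sum>i\<in>S. E i v)"
      by (simp add: sum_E)
  qed simp
  ultimately show ?thesis
    unfolding set_sum_alt[OF fin] by blast
qed

text \<open>The second hypothesis makes \<open>N\<close> triangular for the flag of partial sums of
  the ranges of \<open>E\<close>, with diagonal \<open>t\<close>. Once the components of a kernel
  vector above \<open>h\<close> vanish, component \<open>h\<close> is annihilated by
  \<open>t h\<close>; descending induction does the rest.\<close>

lemma inj_if_triangular:
  assumes "Vector_Spaces.linear scale scale N"
    and "\<And>i h v. h \<le> d \<Longrightarrow> i \<le> h \<Longrightarrow> (\<And>k. k \<le> d \<Longrightarrow> i < k \<Longrightarrow> E k v = 0) \<Longrightarrow> E h (N v - t i *s v) = 0"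
    and "\<And>i. i \<le> d \<Longrightarrow> t i \<noteq> 0"
  shows "inj N"
proof -
  interpret N: Vector_Spaces.linear scale scale N by (rule assms(1))
  have "v = 0" if "N v = 0" for v
  proof (rule eq_0_if_E_eq_0)
    show "E h v = 0" if "h \<le> d" for h
      using that
    proof (induction "d - h" arbitrary: h rule: less_induct)
      case less
      have "E k v = 0" if "k \<le> d" "h < k" for k
        using less that by simp
      then have "E h (N v - t h *s v) = 0"
        using less.prems by (intro assms(2)) auto
      then have "t h *s E h v = 0"
        using \<open>N v = 0\<close> less.prems by (simp add: E_diff E_scale del: diff_0)
      then show ?case
        using assms(3) less.prems by simp
    qed
  qed
  then show ?thesis
    using N.inj_iff_eq_0 by blast
qed

text \<open>Tridiagonality is symmetric under \<open>i\<close> to \<open>d - i\<close>. Reversing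
  the idempotents of \<open>A\<close> carries the first split decomposition to the second, so the
  results behind \<open>K\<close> also serve \<open>B\<close>.\<close>

lemma reverse: "tridiagonal_decomposition scale Basis f g (\<lambda>i. E (d - i)) (\<lambda>i. \<theta> (d - i)) d"
proof unfold_locales
  fix v
  show "(\<Sum>i\<le>d. E (d - i) v) = v"
    using sum.nat_diff_reindex[of "\<lambda>i. E i v" "Suc d"] sum_E[of v]
    by (simp add: lessThan_Suc_atMost)
  show "E (d - i) (x + y) = E (d - i) x + E (d - i) y" "E (d - i) (c *s x) = c *s E (d - i) x" for i c x y
    by (simp_all add: E_add E_scale)
  show "E (d - j) (g (E (d - i) v)) = 0" if "i \<le> d" "j \<le> d" "i + 1 < j \<or> j + 1 < i" for i j v
    using that by (intro E_g_E) auto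
qed (use E_E f_E in auto)

end

section \<open>Corners and irreducibility\<close>

locale tridiagonal_system =
  P?: tridiagonal_decomposition scale Basis A As E \<theta> d +
  S: tridiagonal_decomposition scale Basis As A Es \<theta>s d
  for scale :: "'a::field \<Rightarrow> 'b::ab_group_add \<Rightarrow> 'b" (infixr "*s" 75)
    and Basis A As E Es \<theta> \<theta>s d +
  assumes irreducible: "\<And>W. subspace W \<Longrightarrow> A ` W \<subseteq> W \<Longrightarrow> As ` W \<subseteq> W \<Longrightarrow> W = {0} \<or> W = UNIV"
    and E_0_nonzero: "\<exists>v. E 0 v \<noteq> 0"
    and Es_0_nonzero: "\<exists>v. Es 0 v \<noteq> 0"
begin

text \<open>
  \<open>corner (i + 1) j\<close> is the intersection of \<open>E\<^sup>*\<^sub>0V + \<dots> + E\<^sup>*\<^sub>iV\<close> and \<open>E\<^sub>jV + \<dots> + E\<^sub>dV\<close>; the index is shifted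
  so that \<open>corner 0 j\<close> is zero.
\<close>

definition corner :: "nat \<Rightarrow> nat \<Rightarrow> 'b set" where
  "corner i j = {v. (\<forall>h\<le>d. h \<ge> i \<longrightarrow> Es h v = 0) \<and> (\<forall>k\<le>d. k < j \<longrightarrow> E k v = 0)}"

lemma subspace_corner: "subspace (corner i j)"
  by (rule subspaceI) (simp_all add: corner_def E_add E_scale S.E_add S.E_scale)

text \<open>Subtracting \<open>\<theta> j\<close> removes component \<open>j\<close> for
  \<open>E\<close>, while \<open>A\<close> spreads the components for \<open>Es\<close> by at most
  one step.\<close>

lemma A_corner:
  assumes "v \<in> corner i j"
  shows "A v - \<theta> j *s v \<in> corner (Suc i) (Suc j)"
  using assms unfolding corner_def
  by (auto simp: E_diff E_scale E_f S.E_diff S.E_scale less_Suc_eq intro!: S.E_g_eq_0)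

text \<open>Dual to \<open>A_corner\<close>: subtracting \<open>\<theta>s i\<close> removes the top
  component for \<open>Es\<close>. For \<open>j = 0\<close> the condition on \<open>E\<close> is
  empty before and after, in accordance with truncated subtraction.\<close>

lemma As_corner:
  assumes "v \<in> corner (Suc i) j"
  shows "As v - \<theta>s i *s v \<in> corner i (j - 1)"
proof -
  have "Es h (As v - \<theta>s i *s v) = 0" if "h \<le> d" "i \<le> h" for h
    using assms that unfolding corner_def
    by (cases "h = i") (auto simp: S.E_diff S.E_scale S.E_f)
  moreover have "E k (As v - \<theta>s i *s v) = 0" if "k \<le> d" "k < j - 1" for k
    using assms that unfolding corner_def
    by (auto simp: E_diff E_scale intro!: E_g_eq_0)
  ultimately show ?thesis
    unfolding corner_def by blast
qed

lemma corner_0: "corner 0 j = {0}"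
  using S.eq_0_if_E_eq_0 by (auto simp: corner_def)

lemma span_UN_invariant:
  assumes "\<And>v i. v \<in> X i \<Longrightarrow> h v - c i *s v \<in> X (n i)" and "Vector_Spaces.linear scale scale h"
  shows "h ` span (\<Union>i. X i) \<subseteq> span (\<Union>i. X i)"
proof -
  interpret h: Vector_Spaces.linear scale scale h
    by (rule assms(2))
  have "h v \<in> span (\<Union>i. X i)" if v: "v \<in> X i" for v i
  proof -
    have "h v = (h v - c i *s v) + c i *s v"
      by simp
    moreover have "h v - c i *s v \<in> span (\<Union>i. X i)" "v \<in> span (\<Union>i. X i)"
      using assms(1)[OF v] v span_base by blast+
    ultimately show ?thesis
      by (metis span_add span_scale)
  qed
  then have "h ` (\<Union>i. X i) \<subseteq> span (\<Union>i. X i)"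
    by blast
  then show ?thesis
    by (metis h.span_image span_mono span_span)
qed

text \<open>The diagonal corners span an invariant subspace inside \<open>E\<^sub>1V + \<dots> + E\<^sub>dV\<close>.\<close>

lemma corner_diagonal: "corner i i = {0}"
proof -
  let ?W = "span (\<Union>i. corner i i)"
  have "A ` ?W \<subseteq> ?W"
    by (rule span_UN_invariant[where n = Suc]) (auto intro: A_corner P.linear_f)
  moreover have "As ` ?W \<subseteq> ?W"
  \<comment> \<open>For \<open>i = 0\<close> the corner is zero, so the truncated
    \<open>i - 1\<close> does no harm.\<close>
  proof (rule span_UN_invariant[where n = "\<lambda>i. i - 1"])
    fix v i
    assume "v \<in> corner i i"
    then show "As v - \<theta>s (i - 1) *s v \<in> corner (i - 1) (i - 1)"
      using As_corner[of v "i - 1" i] by (cases i) (simp_all add: corner_0)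
  qed (rule P.linear_g)
  moreover have "?W \<noteq> UNIV"
  proof -
    have "E 0 v = 0" if "v \<in> corner i i" for v i
      using that by (cases i) (auto simp: corner_0 corner_def[of "Suc _"])
    then have "(\<Union>i. corner i i) \<subseteq> {v. E 0 v = 0}"
      by blast
    moreover have "subspace {v. E 0 v = 0}"
      by (rule subspaceI) (simp_all add: E_add E_scale)
    ultimately have "?W \<subseteq> {v. E 0 v = 0}"
      by (rule span_minimal)
    then show ?thesis
      using E_0_nonzero by blast
  qed
  ultimately have "?W = {0}"
    using irreducible subspace_span by blast
  then have "corner i i \<subseteq> {0}"
    using span_superset[of "\<Union>i. corner i i"] by blast
  then show ?thesis
    using subspace_0[OF subspace_corner] by blast
qed

section \<open>The summands of the split decomposition\<close>

definition U :: "nat \<Rightarrow> 'b set" where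
  "U i = corner (Suc i) i"

lemma subspace_U: "subspace (U i)"
  by (simp add: U_def subspace_corner)

lemma A_U: "v \<in> U i \<Longrightarrow> A v - \<theta> i *s v \<in> U (Suc i)"
  by (simp add: U_def A_corner)

lemma As_U_0: "v \<in> U 0 \<Longrightarrow> As v = \<theta>s 0 *s v"
  using As_corner[of v 0 0] by (simp add: U_def corner_0)

lemma As_U_Suc: "v \<in> U (Suc i) \<Longrightarrow> As v - \<theta>s (Suc i) *s v \<in> U i"
  using As_corner[of v "Suc i" "Suc i"] by (simp add: U_def)

lemma U_gt: "i > d \<Longrightarrow> U i = {0}"
  using eq_0_if_E_eq_0 by (auto simp: U_def corner_def)

lemma U_0: "v \<in> U 0 \<longleftrightarrow> (\<forall>h\<le>d. h \<noteq> 0 \<longrightarrow> Es h v = 0)"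
  by (auto simp: U_def corner_def Suc_le_eq)

text \<open>Up to scalars, \<open>A\<close> moves each summand one step up and \<open>As\<close> one
  step down, so the span is invariant. It is nonzero because \<open>U 0\<close> contains the range
  of \<open>Es 0\<close>.\<close>

lemma span_U: "span (\<Union>i. U i) = UNIV"
proof -
  let ?W = "span (\<Union>i. U i)"
  have "A ` ?W \<subseteq> ?W"
    by (rule span_UN_invariant[where n = Suc]) (auto intro: A_U P.linear_f)
  moreover have "As ` ?W \<subseteq> ?W"
  proof (rule span_UN_invariant[where n = "\<lambda>i. i - 1"])
    fix v i
    assume "v \<in> U i"
    then show "As v - \<theta>s i *s v \<in> U (i - 1)"
      using subspace_0[OF subspace_U]
      by (cases i) (simp_all add: As_U_0 As_U_Suc)
  qed (rule P.linear_g)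
  moreover have "?W \<noteq> {0}"
  proof -
    obtain v where v: "Es 0 v \<noteq> 0"
      using Es_0_nonzero by blast
    then have "Es 0 v \<in> U 0"
      by (simp add: U_0 S.E_E)
    then show ?thesis
      using v span_base[of "Es 0 v" "\<Union>i. U i"] by auto
  qed
  ultimately show ?thesis
    using irreducible subspace_span by blast
qed

lemma split_eq_U:
  assumes "i \<le> d"
  shows "(\<Sum>j\<in>{0..i}. range (Es j)) \<inter> (\<Sum>j\<in>{i..d}. range (E j)) = U i"
proof -
  have "{0..i} \<subseteq> {..d}" "{i..d} \<subseteq> {..d}"
    using assms by auto
  then show ?thesis
    using assms by (auto simp: sum_range_E S.sum_range_E U_def corner_def)
qed

lemma U_decomposition:
  obtains u where "\<And>i. u i \<in> U i" and "v = (\<Sum>i\<le>d. u i)"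
proof -
  let ?D = "{v. \<exists>u. (\<forall>i. u i \<in> U i) \<and> v = (\<Sum>i\<le>d. u i)}"
  have "subspace ?D"
  proof (rule subspaceI)
    show "0 \<in> ?D"
      by (auto intro!: exI[of _ "\<lambda>_. 0"] subspace_0 subspace_U)
    show "x + y \<in> ?D" if "x \<in> ?D" "y \<in> ?D" for x y
    proof -
      obtain u w where "\<forall>i. u i \<in> U i" "x = (\<Sum>i\<le>d. u i)" "\<forall>i. w i \<in> U i" "y = (\<Sum>i\<le>d. w i)"
        using \<open>x \<in> ?D\<close> \<open>y \<in> ?D\<close> by blast
      then show ?thesis
        by (auto intro!: exI[of _ "\<lambda>i. u i + w i"] simp: sum.distrib subspace_U subspace_add)
    qed
    show "c *s x \<in> ?D" if "x \<in> ?D" for c x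
    proof -
      obtain u where "\<forall>i. u i \<in> U i" "x = (\<Sum>i\<le>d. u i)"
        using \<open>x \<in> ?D\<close> by blast
      then show ?thesis
        by (auto intro!: exI[of _ "\<lambda>i. c *s u i"] simp: scale_sum_right subspace_U subspace_scale)
    qed
  qed
  moreover have "(\<Union>i. U i) \<subseteq> ?D"
  proof safe
    fix v i
    assume v: "v \<in> U i"
    show "\<exists>u. (\<forall>i. u i \<in> U i) \<and> v = (\<Sum>i\<le>d. u i)"
    proof (cases "i \<le> d")
      case True
      then show ?thesis
        using v by (intro exI[of _ "\<lambda>j. if j = i then v else 0"])
          (simp add: subspace_0 subspace_U)
    next
      case False
      then show ?thesis
        using v U_gt[of i] by (intro exI[of _ "\<lambda>_. 0"]) (simp add: subspace_0 subspace_U)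
    qed
  qed
  ultimately have "span (\<Union>i. U i) \<subseteq> ?D"
    by (rule span_minimal[rotated])
  then show thesis
    using that span_U by blast
qed

text \<open>The last nonzero summand \<open>u m\<close> has no \<open>E\<close> component below
  \<open>m\<close>; being minus the sum of the earlier ones, it has no \<open>Es\<close> component
  from \<open>m\<close> on. So it lies in \<open>corner m m\<close>, which is zero.\<close>

lemma U_independent:
  assumes "\<And>i. u i \<in> U i" and "(\<Sum>i\<le>d. u i) = 0" and "i \<le> d"
  shows "u i = 0"
proof (rule ccontr)
  assume "u i \<noteq> 0"
  define m where "m = Max {i. i \<le> d \<and> u i \<noteq> 0}"
  have ne: "{i. i \<le> d \<and> u i \<noteq> 0} \<noteq> {}"
    using \<open>u i \<noteq> 0\<close> \<open>i \<le> d\<close> by blast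
  have fin: "finite {i. i \<le> d \<and> u i \<noteq> 0}"
    by simp
  have m: "m \<le> d" "u m \<noteq> 0"
    using Max_in[OF fin ne] by (auto simp: m_def)
  have above: "u i = 0" if "m < i" "i \<le> d" for i
  proof (rule ccontr)
    assume "u i \<noteq> 0"
    then show False
      using Max_ge[OF fin, of i] that unfolding m_def[symmetric] by simp
  qed
  have "(\<Sum>i\<le>d. u i) = (\<Sum>i\<le>m. u i)"
    using m above by (intro sum.mono_neutral_right) auto
  also have "\<dots> = (\<Sum>i<m. u i) + u m"
    by (simp flip: lessThan_Suc_atMost)
  finally have um: "u m = 0 - (\<Sum>i<m. u i)"
    using assms(2) by (simp add: eq_neg_iff_add_eq_0 add.commute)
  have "Es h (u i) = 0" if "i < m" "m \<le> h" "h \<le> d" for i h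
    using assms(1)[of i] that by (auto simp: U_def corner_def)
  then have "Es h (u m) = 0" if "m \<le> h" "h \<le> d" for h
    unfolding um using that by (simp add: S.E_diff S.E_sum del: diff_0)
  then have "u m \<in> corner m m"
    using assms(1)[of m] by (auto simp: U_def corner_def)
  then show False
    using m corner_diagonal by blast
qed

section \<open>Maps that are scalar on each summand\<close>

lemma scalar_on_U_exists:
  "\<exists>h. Vector_Spaces.linear scale scale h \<and> (\<forall>i. \<forall>v\<in>U i. h v = c i *s v)"
proof -
  have "\<forall>v. \<exists>u. (\<forall>i. u i \<in> U i) \<and> v = (\<Sum>i\<le>d. u i)"
    using U_decomposition by metis
  then obtain u where u: "\<And>v i. u v i \<in> U i" "\<And>v. v = (\<Sum>i\<le>d. u v i)"
    by metis
  \<comment> \<open>Uniqueness of the components makes the chosen \<open>u\<close> additive and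
    homogeneous in \<open>v\<close>.\<close>
  have uniq: "u v i = w i" if "\<And>i. w i \<in> U i" "v = (\<Sum>i\<le>d. w i)" "i \<le> d" for v w i
  proof -
    have "(\<Sum>i\<le>d. u v i - w i) = 0"
      using that(2) u(2)[of v] by (simp add: sum_subtractf)
    then have "u v i - w i = 0"
      using that u(1) by (intro U_independent[of "\<lambda>i. u v i - w i"]) (auto intro: subspace_diff subspace_U)
    then show ?thesis
      by simp
  qed
  define h where "h v = (\<Sum>i\<le>d. c i *s u v i)" for v
  have "h (x + y) = h x + h y" for x y
  proof -
    have "u (x + y) i = u x i + u y i" if "i \<le> d" for i
      using u that by (intro uniq[where w = "\<lambda>i. u x i + u y i"]) (auto intro: subspace_add subspace_U simp: sum.distrib)
    then show ?thesis
      by (simp add: h_def scale_right_distrib sum.distrib)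
  qed
  moreover have "h (t *s x) = t *s h x" for t x
  proof -
    have "u (t *s x) i = t *s u x i" if "i \<le> d" for i
      using u that by (intro uniq[where w = "\<lambda>i. t *s u x i"])
        (auto intro: subspace_scale subspace_U simp flip: scale_sum_right)
    then show ?thesis
      by (simp add: h_def scale_sum_right mult.commute)
  qed
  ultimately have "Vector_Spaces.linear scale scale h"
    by unfold_locales
  moreover have "h v = c i *s v" if v: "v \<in> U i" for i v
  proof (cases "i \<le> d")
    case True
    have "u v j = (if j = i then v else 0)" if "j \<le> d" for j
      using v True that by (intro uniq[where w = "\<lambda>j. if j = i then v else 0"]) (auto intro: subspace_0 subspace_U)
    then have "h v = (\<Sum>j\<le>d. if j = i then c i *s v else 0)"
      unfolding h_def by (intro sum.cong) auto
    then show ?thesis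
      using True by simp
  next
    case False
    then have "v = 0"
      using v U_gt[of i] by simp
    then show ?thesis
      using \<open>Vector_Spaces.linear scale scale h\<close>
      by (simp add: linear_iff_module_hom module_hom.zero)
  qed
  ultimately show ?thesis
    by blast
qed

lemma linear_eq_on_U:
  assumes "Vector_Spaces.linear scale scale h" and "Vector_Spaces.linear scale scale h'"
    and "\<And>i v. i \<le> d \<Longrightarrow> v \<in> U i \<Longrightarrow> h v = h' v"
  shows "h = h'"
proof
  fix v
  interpret h: Vector_Spaces.linear scale scale h by (rule assms)
  interpret h': Vector_Spaces.linear scale scale h' by (rule assms)
  obtain u where "\<And>i. u i \<in> U i" and "v = (\<Sum>i\<le>d. u i)"
    using U_decomposition by blast
  then show "h v = h' v"
    using assms(3) by (simp add: h.sum h'.sum)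
qed

text \<open>
  For \<open>c i = q\<^bsup>d - 2i\<^esup>\<close> this is \<open>K\<close>; in the system with the idempotents of \<open>A\<close> in reversed order it is \<open>B\<close>.
\<close>

definition split_map :: "(nat \<Rightarrow> 'a) \<Rightarrow> 'b \<Rightarrow> 'b" where
  "split_map c = (THE h. Vector_Spaces.linear scale scale h \<and> (\<forall>i\<le>d. \<forall>v\<in>U i. h v = c i *s v))"

lemma split_map:
  shows linear_split_map: "Vector_Spaces.linear scale scale (split_map c)"
    and split_map_U: "v \<in> U i \<Longrightarrow> split_map c v = c i *s v"
proof -
  obtain h where h: "Vector_Spaces.linear scale scale h" "\<And>i v. v \<in> U i \<Longrightarrow> h v = c i *s v"
    using scalar_on_U_exists by blast
  have "split_map c = h"
    unfolding split_map_def by (rule the_equality) (use h linear_eq_on_U in force)+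
  then show "Vector_Spaces.linear scale scale (split_map c)" "v \<in> U i \<Longrightarrow> split_map c v = c i *s v"
    using h by simp_all
qed

lemma bij_split_map:
  assumes "\<And>i. i \<le> d \<Longrightarrow> c i \<noteq> 0"
  shows "bij (split_map c)"
proof -
  have "split_map c \<circ> split_map c' = id" if "\<And>i. i \<le> d \<Longrightarrow> c i * c' i = 1" for c c'
  proof (rule linear_eq_on_U)
    show "Vector_Spaces.linear scale scale (split_map c \<circ> split_map c')"
      by (rule Vector_Spaces.linear_compose[OF linear_split_map linear_split_map])
    show "Vector_Spaces.linear scale scale id"
      by (rule linear_id)
    fix i v
    assume "i \<le> d" "v \<in> U i"
    then show "(split_map c \<circ> split_map c') v = id v"
      using that[of i] by (simp add: split_map_U[of _ i] subspace_U subspace_scale)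
  qed
  from this[of c "\<lambda>i. inverse (c i)"] this[of "\<lambda>i. inverse (c i)" c] show ?thesis
    using assms by (intro o_bij[of "split_map (\<lambda>i. inverse (c i))"]) simp_all
qed

text \<open>If \<open>v\<close> has no \<open>Es\<close> component above \<open>i\<close>, its
  summands beyond \<open>U i\<close> add up to a vector of \<open>corner (Suc i) (Suc i)\<close>,
  hence to zero. Of the others, the one in \<open>U i\<close> is scaled by \<open>c i\<close> and
  the earlier ones lie strictly lower in the flag.\<close>

lemma split_map_flag:
  assumes "\<And>h. h \<le> d \<Longrightarrow> i < h \<Longrightarrow> Es h v = 0" and "h \<le> d" "i \<le> h"
  shows "Es h (split_map c v - c i *s v) = 0"
proof -
  interpret K: Vector_Spaces.linear scale scale "split_map c"
    by (rule linear_split_map)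
  obtain u where u: "\<And>i. u i \<in> U i" and v: "v = (\<Sum>i\<le>d. u i)"
    using U_decomposition by blast
  have Es_u: "Es h (u j) = 0" if "j < h" "h \<le> d" for j h
    using u[of j] that by (auto simp: U_def corner_def)
  show ?thesis
  proof (cases "i \<le> d")
    case True
    have split: "v = (\<Sum>j\<le>i. u j) + (\<Sum>j\<in>{i<..d}. u j)"
    proof -
      have "{..d} = {..i} \<union> {i<..d}"
        using True by auto
      then show ?thesis
        unfolding v by (simp add: sum.union_disjoint ivl_disj_int)
    qed
    have "Es h (\<Sum>j\<in>{i<..d}. u j) = 0" if "h \<le> d" "i < h" for h
    proof -
      have "Es h (\<Sum>j\<le>i. u j) = 0"
        using that Es_u by (simp add: S.E_sum)
      then show ?thesis
        using that assms(1)[of h] split S.E_add[of h] by simp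
    qed
    moreover have "E k (u j) = 0" if "k \<le> d" "k < j" for k j
      using u[of j] that by (auto simp: U_def corner_def)
    then have "E k (\<Sum>j\<in>{i<..d}. u j) = 0" if "k \<le> d" "k < Suc i" for k
      using that by (simp add: E_sum)
    ultimately have "(\<Sum>j\<in>{i<..d}. u j) \<in> corner (Suc i) (Suc i)"
      by (simp add: corner_def)
    then have v': "v = (\<Sum>j\<le>i. u j)"
      using split by (simp add: corner_diagonal)
    have "Es h (c j *s u j - c i *s u j) = 0" if "j \<le> i" for j
      using that assms(2,3) Es_u[of j h] by (cases "j = i") (auto simp: S.E_diff S.E_scale)
    then have "Es h (\<Sum>j\<le>i. c j *s u j - c i *s u j) = 0"
      using assms(2) by (simp add: S.E_sum)
    then show ?thesis
      unfolding v' by (simp add: K.sum split_map_U[OF u] scale_sum_right sum_subtractf)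
  next
    case False
    then show ?thesis
      using assms(2,3) by simp
  qed
qed

section \<open>Commutation relations with \<open>A\<close> and \<open>As\<close>\<close>

lemma A_split_map:
  assumes c: "\<And>i. c (Suc i) = p * c i" and \<theta>: "\<And>i. i \<le> d \<Longrightarrow> \<theta> i * c i = x * (c i * c i) + y"
  shows "split_map c (A v) = p *s A (split_map c v) + ((1 - p) * x) *s split_map c (split_map c v) + ((1 - p) * y) *s v"
proof -
  interpret K: Vector_Spaces.linear scale scale "split_map c"
    by (rule linear_split_map)
  have "(\<lambda>v. split_map c (A v)) =
    (\<lambda>v. p *s A (split_map c v) + ((1 - p) * x) *s split_map c (split_map c v) + ((1 - p) * y) *s v)"
  proof (rule linear_eq_on_U)
    fix i v
    assume i: "i \<le> d" and v: "v \<in> U i"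
    \<comment> \<open>The remainder \<open>r\<close> lies in \<open>U (Suc i)\<close>, where the map
      is \<open>p * c i\<close>, so the terms in \<open>r\<close> agree on both sides. The
      hypothesis on \<open>\<theta>\<close> matches the coefficients of \<open>v\<close>.\<close>
    define r where "r = A v - \<theta> i *s v"
    have r: "split_map c r = (p * c i) *s r"
      using split_map_U[OF A_U[OF v], of c] c[of i] by (simp add: r_def)
    have A: "A v = \<theta> i *s v + r"
      by (simp add: r_def)
    have "\<theta> i * c i = p * (\<theta> i * c i) + (1 - p) * x * (c i * c i) + (1 - p) * y"
      unfolding \<theta>[OF i] by (simp add: algebra_simps)
    then have "(\<theta> i * c i) *s v = (p * (\<theta> i * c i) + (1 - p) * x * (c i * c i) + (1 - p) * y) *s v"
      by (rule arg_cong)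
    then have "(\<theta> i * c i) *s v = (p * (\<theta> i * c i)) *s v + ((1 - p) * x * (c i * c i)) *s v + ((1 - p) * y) *s v"
      by (simp only: scale_left_distrib)
    then have "(\<theta> i * c i) *s v + (p * c i) *s r =
      (p * (\<theta> i * c i)) *s v + ((1 - p) * x * (c i * c i)) *s v + ((1 - p) * y) *s v + (p * c i) *s r"
      by (rule arg_cong)
    moreover have "split_map c (A v) = (\<theta> i * c i) *s v + (p * c i) *s r"
      by (simp add: A K.add K.scale r split_map_U[OF v])
    moreover have "p *s A (split_map c v) + ((1 - p) * x) *s split_map c (split_map c v) + ((1 - p) * y) *s v =
      (p * (\<theta> i * c i)) *s v + ((1 - p) * x * (c i * c i)) *s v + ((1 - p) * y) *s v + (p * c i) *s r"
      by (simp add: P.f.scale K.scale split_map_U[OF v] A scale_right_distrib ac_simps)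
    ultimately show "split_map c (A v) =
      p *s A (split_map c v) + ((1 - p) * x) *s split_map c (split_map c v) + ((1 - p) * y) *s v"
      by (simp only:)
  qed (unfold_locales, simp_all add: K.add K.scale P.f.add P.f.scale scale_right_distrib mult_ac)
  then show ?thesis
    unfolding fun_eq_iff by blast
qed

text \<open>Since \<open>As\<close> lowers the index, \<open>p\<close> now belongs to the product in
  which \<open>As\<close> acts first: \<open>p * c j = c (Suc j)\<close>. On \<open>U 0\<close> the
  remainder is zero.\<close>

lemma As_split_map:
  assumes c: "\<And>i. c (Suc i) = p * c i" and \<theta>: "\<And>i. i \<le> d \<Longrightarrow> \<theta>s i * c i = x * (c i * c i) + y"
  shows "As (split_map c v) = p *s split_map c (As v) + ((1 - p) * x) *s split_map c (split_map c v) + ((1 - p) * y) *s v"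
proof -
  interpret K: Vector_Spaces.linear scale scale "split_map c"
    by (rule linear_split_map)
  have "(\<lambda>v. As (split_map c v)) =
    (\<lambda>v. p *s split_map c (As v) + ((1 - p) * x) *s split_map c (split_map c v) + ((1 - p) * y) *s v)"
  proof (rule linear_eq_on_U)
    fix i v
    assume i: "i \<le> d" and v: "v \<in> U i"
    define l where "l = As v - \<theta>s i *s v"
    have l: "p *s split_map c l = c i *s l"
    proof (cases i)
      case 0
      then show ?thesis
        using v by (simp add: l_def As_U_0 K.zero)
    next
      case (Suc j)
      then show ?thesis
        using split_map_U[OF As_U_Suc, of v j c] v c[of j] by (simp add: l_def)
    qed
    have As: "As v = \<theta>s i *s v + l"
      by (simp add: l_def)
    have "\<theta>s i * c i = p * (\<theta>s i * c i) + (1 - p) * x * (c i * c i) + (1 - p) * y"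
      unfolding \<theta>[OF i] by (simp add: algebra_simps)
    then have "(\<theta>s i * c i) *s v = (p * (\<theta>s i * c i) + (1 - p) * x * (c i * c i) + (1 - p) * y) *s v"
      by (rule arg_cong)
    then have "(\<theta>s i * c i) *s v = (p * (\<theta>s i * c i)) *s v + ((1 - p) * x * (c i * c i)) *s v + ((1 - p) * y) *s v"
      by (simp only: scale_left_distrib)
    then have "(\<theta>s i * c i) *s v + c i *s l =
      (p * (\<theta>s i * c i)) *s v + ((1 - p) * x * (c i * c i)) *s v + ((1 - p) * y) *s v + c i *s l"
      by (rule arg_cong)
    moreover have "As (split_map c v) = (\<theta>s i * c i) *s v + c i *s l"
      by (simp add: As P.g.scale split_map_U[OF v] scale_right_distrib mult.commute)
    moreover have "p *s split_map c (As v) + ((1 - p) * x) *s split_map c (split_map c v) + ((1 - p) * y) *s v =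
      (p * (\<theta>s i * c i)) *s v + ((1 - p) * x * (c i * c i)) *s v + ((1 - p) * y) *s v + c i *s l"
      by (simp add: As K.add K.scale l split_map_U[OF v] scale_right_distrib mult.assoc add_ac)
    ultimately show "As (split_map c v) =
      p *s split_map c (As v) + ((1 - p) * x) *s split_map c (split_map c v) + ((1 - p) * y) *s v"
      by (simp only:)
  qed (unfold_locales, simp_all add: K.add K.scale P.g.add P.g.scale scale_right_distrib mult_ac)
  then show ?thesis
    unfolding fun_eq_iff by blast
qed

end

section \<open>The quadratic relation between \<open>K\<close> and \<open>B\<close>\<close>

text \<open>The largest \<open>H\<close>-invariant subset of the kernel of \<open>Q\<close>.\<close>

definition word_kernel :: "('b \<Rightarrow> 'b) set \<Rightarrow> ('b \<Rightarrow> 'b::zero) \<Rightarrow> 'b set" where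
  "word_kernel H Q = {v. \<forall>hs\<in>lists H. Q (fold (\<lambda>h. h) hs v) = 0}"

lemma word_kernel_step:
  assumes "v \<in> word_kernel H Q" and "h \<in> H"
  shows "h v \<in> word_kernel H Q"
  unfolding word_kernel_def
proof (intro CollectI ballI)
  fix hs
  assume "hs \<in> lists H"
  then have "h # hs \<in> lists H"
    using assms by simp
  then show "Q (fold (\<lambda>h. h) hs (h v)) = 0"
    using assms(1) bspec[of "lists H" "\<lambda>hs. Q (fold (\<lambda>h. h) hs v) = 0" "h # hs"]
    by (simp add: word_kernel_def)
qed

lemma word_kernel_kernel: "v \<in> word_kernel H Q \<Longrightarrow> Q v = 0"
  unfolding word_kernel_def by (auto dest: bspec[of _ _ "[]"])

section \<open>Invariance of the word kernel\<close>

context vector_space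
begin

lemma linear_rules:
  assumes "Vector_Spaces.linear scale scale h"
  shows "h (x + y) = h x + h y" "h (x - y) = h x - h y" "h (c *s x) = c *s h x" "h 0 = 0"
  using assms
  by (simp_all add: linear_iff_module_hom module_hom.add module_hom.diff module_hom.scale module_hom.zero)

lemma linear_word:
  assumes "\<And>h. h \<in> H \<Longrightarrow> Vector_Spaces.linear scale scale h"
    and "Vector_Spaces.linear scale scale Q" and "hs \<in> lists H"
  shows "Vector_Spaces.linear scale scale (\<lambda>v. Q (fold (\<lambda>h. h) hs v))"
  using assms(3)
proof (induction hs)
  case Nil
  then show ?case
    using assms(2) by simp
next
  case (Cons h hs)
  then show ?case
    using Vector_Spaces.linear_compose[OF assms(1)[OF Cons.hyps(1)] Cons.IH]
    by (simp add: comp_def)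
qed

lemma subspace_word_kernel:
  assumes "\<And>h. h \<in> H \<Longrightarrow> Vector_Spaces.linear scale scale h"
    and "Vector_Spaces.linear scale scale Q"
  shows "subspace (word_kernel H Q)"
  by (rule subspaceI) (simp_all add: word_kernel_def linear_rules[OF linear_word[OF assms]])

text \<open>Moving \<open>f\<close> outwards past one map of a word leaves, besides the moved term,
  only words applied to \<open>v\<close>, which \<open>Q\<close> kills. Induction on the word, for
  all \<open>v\<close>, ends at the empty word, where \<open>kernel\<close> applies.\<close>

lemma word_kernel_invariant:
  assumes "\<And>h. h \<in> H \<Longrightarrow> Vector_Spaces.linear scale scale h"
    and "Vector_Spaces.linear scale scale Q"
    and comm: "\<And>h. h \<in> H \<Longrightarrow> \<exists>p x y. \<forall>v. h (f v) = p *s f (h v) + x *s h (h v) + y *s v"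
    and kernel: "\<And>v. Q v = 0 \<Longrightarrow> (\<And>h. h \<in> H \<Longrightarrow> Q (h v) = 0) \<Longrightarrow> Q (f v) = 0"
  shows "f ` word_kernel H Q \<subseteq> word_kernel H Q"
proof -
  have "Q (fold (\<lambda>h. h) hs (f v)) = 0" if "hs \<in> lists H" "v \<in> word_kernel H Q" for hs v
    using that
  proof (induction hs arbitrary: v)
    case Nil
    then show ?case
      using kernel[of v] word_kernel_kernel[of _ H Q] word_kernel_step[of v H Q] by simp
  next
    case (Cons h hs)
    obtain p x y where hf: "h (f v) = p *s f (h v) + x *s h (h v) + y *s v"
      using comm[OF Cons.hyps(1)] by blast
    have hv: "h v \<in> word_kernel H Q" "h (h v) \<in> word_kernel H Q"
      using Cons word_kernel_step by blast+
    then have "Q (fold (\<lambda>h. h) hs (h (h v))) = 0" "Q (fold (\<lambda>h. h) hs v) = 0"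
      using Cons by (simp_all add: word_kernel_def)
    then show ?case
      using Cons.IH[OF hv(1)] by (simp add: hf linear_rules[OF linear_word[OF assms(1,2) Cons.hyps(2)]])
  qed
  then show ?thesis
    unfolding word_kernel_def[of H Q] by blast
qed

text \<open>\<open>a'\<close> and \<open>b'\<close> stand for the inverses of \<open>a\<close> and
  \<open>b\<close>. \<open>B\<close> comes from the reversed order of the idempotents of
  \<open>A\<close>, hence the exchange of \<open>a\<close> and \<open>a'\<close> in
  \<open>BA\<close>; the order for \<open>As\<close> is kept, so \<open>AsK\<close> and
  \<open>AsB\<close> have the same shape.\<close>

lemma quadratic_relation:
  assumes linear_A: "Vector_Spaces.linear scale scale A" and linear_As: "Vector_Spaces.linear scale scale As"
    and linear_K: "Vector_Spaces.linear scale scale K" and linear_B: "Vector_Spaces.linear scale scale B"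
    and irreducible: "\<And>W. subspace W \<Longrightarrow> A ` W \<subseteq> W \<Longrightarrow> As ` W \<subseteq> W \<Longrightarrow> W = {0} \<or> W = UNIV"
    and KA: "\<And>v. K (A v) = p *s A (K v) + ((1 - p) * a) *s K (K v) + ((1 - p) * a') *s v"
    and BA: "\<And>v. B (A v) = p *s A (B v) + ((1 - p) * a') *s B (B v) + ((1 - p) * a) *s v"
    and AsK: "\<And>v. As (K v) = p *s K (As v) + ((1 - p) * b) *s K (K v) + ((1 - p) * b') *s v"
    and AsB: "\<And>v. As (B v) = p *s B (As v) + ((1 - p) * b) *s B (B v) + ((1 - p) * b') *s v"
    and "p \<noteq> 0" and "a \<noteq> a'"
    and v0: "v0 \<noteq> 0" "K v0 = \<kappa> *s v0" "B v0 = \<kappa> *s v0"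
  shows "((1 - p) * a) *s K (K v) - (a' - p * a) *s K (B v) - (a - p * a') *s B (K v)
    + ((1 - p) * a') *s B (B v) = 0"
proof -
  define Q where "Q v = ((1 - p) * a) *s K (K v) - (a' - p * a) *s K (B v) - (a - p * a') *s B (K v)
    + ((1 - p) * a') *s B (B v)" for v
  note A = linear_rules[OF linear_A] and As = linear_rules[OF linear_As]
    and K = linear_rules[OF linear_K] and B = linear_rules[OF linear_B]
  have linear_Q: "Vector_Spaces.linear scale scale Q"
    by unfold_locales (simp_all add: Q_def K B scale_right_distrib scale_right_diff_distrib mult_ac)
  let ?W = "word_kernel {K, B} Q"
  have lin: "Vector_Spaces.linear scale scale h" if "h \<in> {K, B}" for h
    using that linear_K linear_B by blast
  have "A ` ?W \<subseteq> ?W"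
  proof (rule word_kernel_invariant[OF lin linear_Q])
    show "\<exists>p x y. \<forall>v. h (A v) = p *s A (h v) + x *s h (h v) + y *s v" if "h \<in> {K, B}" for h
      using that KA BA by blast
    \<comment> \<open>The factor \<open>a - a'\<close> clears the denominators of the coefficients.\<close>
    show "Q (A v) = 0" if "Q v = 0" "\<And>h. h \<in> {K, B} \<Longrightarrow> Q (h v) = 0" for v
    proof -
      have "(a - a') *s Q (A v) = ((a - a') * p * p) *s A (Q v)
        + (1 - p) *s ((a * (a - p * a')) *s Q (K v) - (a * (a' - p * a)) *s K (Q v)
          + (a' * (a - p * a')) *s B (Q v) - (a' * (a' - p * a)) *s Q (B v))"
        by (simp add: Q_def A K B KA BA algebra_simps)
      then show ?thesis
        using that \<open>a \<noteq> a'\<close> by (simp add: A K B)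
    qed
  qed
  moreover have "As ` ?W \<subseteq> ?W"
  proof (rule word_kernel_invariant[OF lin linear_Q])
    show "\<exists>p x y. \<forall>v. h (As v) = p *s As (h v) + x *s h (h v) + y *s v" if "h \<in> {K, B}" for h
    proof (intro exI allI)
      fix v
      \<comment> \<open>\<open>AsK\<close> and \<open>AsB\<close> carry \<open>p\<close> on the term
        \<open>h (As v)\<close>, so they are solved for it by dividing by \<open>p\<close>.\<close>
      have "p *s h (As v) = As (h v) - ((1 - p) * b) *s h (h v) - ((1 - p) * b') *s v"
        using that AsK AsB by auto
      then have "inverse p *s (p *s h (As v)) =
        inverse p *s (As (h v) - ((1 - p) * b) *s h (h v) - ((1 - p) * b') *s v)"
        by (rule arg_cong)
      then show "h (As v) = inverse p *s As (h v) + (- (inverse p * ((1 - p) * b))) *s h (h v)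
          + (- (inverse p * ((1 - p) * b'))) *s v"
        using \<open>p \<noteq> 0\<close> by (simp add: scale_right_diff_distrib)
    qed
    show "Q (As v) = 0" if "Q v = 0" "\<And>h. h \<in> {K, B} \<Longrightarrow> Q (h v) = 0" for v
    proof -
      \<comment> \<open>Here the factor \<open>p * p\<close> sits at \<open>Q (As v)\<close>, so
        isolating that term uses \<open>p \<noteq> 0\<close> as well.\<close>
      have "(a - a') *s As (Q v) = ((a - a') * p * p) *s Q (As v)
        + ((1 - p) * b) *s ((a - p * a') *s Q (K v) - (a' - p * a) *s K (Q v)
          + (a - p * a') *s B (Q v) - (a' - p * a) *s Q (B v))"
        by (simp add: Q_def As K B AsK AsB algebra_simps)
      then show ?thesis
        using that \<open>a \<noteq> a'\<close> \<open>p \<noteq> 0\<close> by (simp add: As K B)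
    qed
  qed
  moreover have "v0 \<in> ?W"
  proof -
    \<comment> \<open>The scalar \<open>c\<close> is general because each map of the word multiplies
      \<open>v0\<close> by \<open>\<kappa>\<close>.\<close>
    have "Q (fold (\<lambda>h. h) hs (c *s v0)) = 0" if "hs \<in> lists {K, B}" for hs c
      using that
    proof (induction hs arbitrary: c)
      case Nil
      \<comment> \<open>The four coefficients add up to zero, so \<open>Q\<close> kills a common
        eigenvector on which \<open>K\<close> and \<open>B\<close> have the same eigenvalue.\<close>
      have "Q (c *s v0) = (c * \<kappa> * \<kappa> * ((1 - p) * a - (a' - p * a) - (a - p * a') + (1 - p) * a')) *s v0"
        by (simp only: Q_def K B v0 scale_scale flip: scale_left_distrib scale_left_diff_distrib)
          (simp add: algebra_simps)
      then show ?case
        by (simp add: algebra_simps)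
    next
      case (Cons h hs)
      then show ?case
        using v0 by (auto simp: K B)
    qed
    from this[of _ 1] show ?thesis
      by (simp add: word_kernel_def)
  qed
  ultimately have "?W = UNIV"
    using irreducible[OF subspace_word_kernel[OF lin linear_Q]] v0 by blast
  then have "Q v = 0"
    by (intro word_kernel_kernel[of v "{K, B}"]) simp
  then show ?thesis
    by (simp add: Q_def)
qed

end

section \<open>The formulas for \<open>M\<close>\<close>

text \<open>The equation forces \<open>T = K \<circ> inv M\<close>, so bijectivity of
  \<open>T\<close> is a consequence and \<open>inv T\<close> is a genuine inverse.\<close>

lemma eq_inv_comp:
  assumes "bij M" and "bij K" and "\<And>v. T (M v) = K v"
  shows "M = inv T \<circ> K"
proof -
  have "T = K \<circ> inv M"
    using assms(3) bij_is_surj[OF assms(1)] by (auto simp: fun_eq_iff surj_f_inv_f simp flip: assms(3))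
  then have "bij T"
    using assms by (simp add: bij_comp bij_imp_bij_inv)
  then show ?thesis
    by (simp add: fun_eq_iff inv_f_f bij_is_inj flip: assms(3))
qed

lemma eq_comp_inv:
  assumes "bij M" and "bij K" and "\<And>v. M (T v) = K v"
  shows "M = K \<circ> inv T"
proof -
  have "T = inv M \<circ> K"
    by (simp add: fun_eq_iff inv_f_f bij_is_inj[OF assms(1)] flip: assms(3))
  then have "bij T"
    using assms by (simp add: bij_comp bij_imp_bij_inv)
  then show ?thesis
    by (simp add: fun_eq_iff surj_f_inv_f bij_is_surj flip: assms(3))
qed

context nonzero_fd_vector_space
begin

text \<open>Let \<open>G\<close> be the map inverted in \<open>psi_map\<close>. Then
  \<open>G \<circ> K\<close> is \<open>q\<close> times \<open>a K - a^-1 B\<close>, so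
  \<open>G\<close> inherits injectivity, and \<open>inv G\<close> sends
  \<open>a K v - a^-1 B v\<close> to \<open>q^-1 K v\<close>. The left factor of
  \<open>psi_map\<close> turns this into \<open>q^-1 (K v - B v)\<close>.\<close>

lemma psi_map_eq:
  assumes linear_K: "Vector_Spaces.linear scale scale K" and linear_B: "Vector_Spaces.linear scale scale B"
    and "bij K" and inj: "inj (\<lambda>v. a *s K v - inverse a *s B v)" and "q \<noteq> 0"
  shows "psi_map q a K B (a *s K v - inverse a *s B v) = inverse q *s (K v - B v)"
proof -
  note K = linear_rules[OF linear_K] and B = linear_rules[OF linear_B]
  have surj_K: "K (inv K v) = v" and inj_K: "inv K (K v) = v" for v
    using \<open>bij K\<close> by (simp_all add: bij_is_surj bij_is_inj surj_f_inv_f)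
  define G where "G v = q *s (a *s v - inverse a *s B (inv K v))" for v
  have G: "G (K v) = q *s (a *s K v - inverse a *s B v)" for v
    by (simp add: G_def inj_K)
  have "inj G"
  proof (rule injI)
    fix x y
    assume "G x = G y"
    then have "G (K (inv K x)) = G (K (inv K y))"
      by (simp add: surj_K)
    then have "a *s K (inv K x) - inverse a *s B (inv K x) = a *s K (inv K y) - inverse a *s B (inv K y)"
      unfolding G using \<open>q \<noteq> 0\<close> by (simp only: scale_cancel_left simp_thms)
    then have "inv K x = inv K y"
      by (rule injD[OF inj])
    then show "x = y"
      by (metis surj_K)
  qed
  moreover have "G (inverse q *s K v) = a *s K v - inverse a *s B v"
    using G[of "inverse q *s v"] \<open>q \<noteq> 0\<close>
    by (simp add: K B scale_right_diff_distrib mult.left_commute)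
  ultimately have "inv G (a *s K v - inverse a *s B v) = inverse q *s K v"
    by (metis inv_f_f)
  moreover have "inv K (inverse q *s K v) = inverse q *s v"
    using inj_K[of "inverse q *s v"] by (simp add: K)
  moreover have "psi_map q a K B w = inv G w - B (inv K (inv G w))" for w
    by (simp add: psi_map_def G_def[abs_def])
  ultimately show ?thesis
    by (simp add: B scale_right_diff_distrib)
qed

lemma M_map_formulas:
  fixes a q :: 'a and K B :: "'b \<Rightarrow> 'b"
  defines "p \<equiv> inverse q * inverse q" and "\<psi> \<equiv> psi_map q a K B" and "M \<equiv> M_map a K B"
  assumes linear_K: "Vector_Spaces.linear scale scale K" and linear_B: "Vector_Spaces.linear scale scale B"
    and "bij K" and "bij B" and inj: "inj (\<lambda>v. a *s K v - inverse a *s B v)"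
    and "q \<noteq> 0" and "a \<noteq> inverse a"
    and quadratic: "\<And>v. ((1 - p) * a) *s K (K v) - (inverse a - p * a) *s K (B v)
      - (a - p * inverse a) *s B (K v) + ((1 - p) * inverse a) *s B (B v) = 0"
  shows "M = inv (\<lambda>v. v - (inverse a * q) *s \<psi> v) \<circ> K"
    and "M = K \<circ> inv (\<lambda>v. v - (inverse a * inverse q) *s \<psi> v)"
    and "M = inv (\<lambda>v. v - (a * q) *s \<psi> v) \<circ> B"
    and "M = B \<circ> inv (\<lambda>v. v - (a * inverse q) *s \<psi> v)"
proof -
  note K = linear_rules[OF linear_K] and B = linear_rules[OF linear_B]
  define a' where "a' = inverse a"
  define e where "e = inverse (a - a')"
  have e: "e * (a - a') = 1" "e \<noteq> 0"
    using \<open>a \<noteq> inverse a\<close> by (simp_all add: e_def a'_def)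
  define N where "N v = a *s K v - a' *s B v" for v
  have linear_N: "Vector_Spaces.linear scale scale N"
    by unfold_locales (simp_all add: N_def K B scale_right_distrib scale_right_diff_distrib mult_ac)
  have "inj N"
    using inj by (simp add: N_def[abs_def] a'_def)
  then have "bij N"
    using linear_N linear_inj_imp_surj by (simp add: bij_def)
  have \<psi>: "\<psi> (N v) = inverse q *s (K v - B v)" for v
    using psi_map_eq[OF linear_K linear_B \<open>bij K\<close> inj \<open>q \<noteq> 0\<close>] by (simp add: \<psi>_def N_def a'_def)
  have M: "M v = N (e *s v)" "M v = e *s N v" for v
    by (simp_all add: M_def M_map_def N_def e_def a'_def K B scale_right_diff_distrib mult_ac)
  have "bij M"
  proof (rule o_bij)
    show "(\<lambda>v. (a - a') *s inv N v) \<circ> M = id" "M \<circ> (\<lambda>v. (a - a') *s inv N v) = id"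
      using e \<open>bij N\<close>
      by (simp_all add: fun_eq_iff M(1) bij_is_inj bij_is_surj surj_f_inv_f mult.commute)
  qed
  have Q: "((1 - p) * a) *s K (K v) - (a' - p * a) *s K (B v) - (a - p * a') *s B (K v)
    + ((1 - p) * a') *s B (B v) = 0" for v
    using quadratic by (simp add: a'_def)
  \<comment> \<open>As \<open>N\<close> is onto, the equation can be tested on vectors
    \<open>N w\<close>, where \<open>\<psi>\<close> becomes \<open>inverse q\<close> times
    \<open>K - B\<close>. The factor \<open>a - a'\<close> cancels the normalization
    \<open>e\<close>.\<close>
  have eq_if_N: "M (v - s *s \<psi> v) = h v"
    if "\<And>w. N (N w) - (s * inverse q) *s N (K w - B w) = (a - a') *s h (N w)" for s h v
  proof -
    have "M (N w - s *s \<psi> (N w)) = h (N w)" for w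
    proof -
      have "M (N w - s *s \<psi> (N w)) = e *s (N (N w) - (s * inverse q) *s N (K w - B w))"
        by (simp add: M(2) \<psi> linear_rules[OF linear_N])
      then show ?thesis
        unfolding that using e by simp
    qed
    from this[of "inv N v"] show ?thesis
      using \<open>bij N\<close> by (simp add: bij_is_surj surj_f_inv_f)
  qed
  show "M = inv (\<lambda>v. v - (inverse a * q) *s \<psi> v) \<circ> K"
  proof (rule eq_inv_comp[OF \<open>bij M\<close> \<open>bij K\<close>])
    fix v
    \<comment> \<open>Up to the factor \<open>e\<close>, the left side is
      \<open>(a K - a' B) - a' (K - B)\<close>, in which \<open>B\<close> cancels; with
      \<open>a\<close> in place of the second \<open>a'\<close>, as in the third formula,
      \<open>K\<close> cancels.\<close>
    have "M v - (a' * q) *s \<psi> (M v) = (e * (a - a')) *s K v"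
      using \<open>q \<noteq> 0\<close> by (simp only: M(1) \<psi>) (simp add: N_def K B algebra_simps)
    then show "M v - (inverse a * q) *s \<psi> (M v) = K v"
      by (simp add: e flip: a'_def)
  qed
  show "M = inv (\<lambda>v. v - (a * q) *s \<psi> v) \<circ> B"
  proof (rule eq_inv_comp[OF \<open>bij M\<close> \<open>bij B\<close>])
    fix v
    have "M v - (a * q) *s \<psi> (M v) = (e * (a - a')) *s B v"
      using \<open>q \<noteq> 0\<close> by (simp only: M(1) \<psi>) (simp add: N_def K B algebra_simps)
    then show "M v - (a * q) *s \<psi> (M v) = B v"
      by (simp add: e)
  qed
  show "M = K \<circ> inv (\<lambda>v. v - (inverse a * inverse q) *s \<psi> v)"
  proof (rule eq_comp_inv[OF \<open>bij M\<close> \<open>bij K\<close>], rule eq_if_N)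
    fix w
    \<comment> \<open>The two sides of the desired equation differ by exactly \<open>a'\<close>
      times the quadratic expression; for the fourth formula the factor is \<open>a\<close>.\<close>
    have "N (N w) - (a' * p) *s N (K w - B w) = (a - a') *s K (N w) + a' *s
      (((1 - p) * a) *s K (K w) - (a' - p * a) *s K (B w) - (a - p * a') *s B (K w)
        + ((1 - p) * a') *s B (B w))"
      by (simp add: N_def K B algebra_simps)
    then show "N (N w) - (inverse a * inverse q * inverse q) *s N (K w - B w) = (a - a') *s K (N w)"
      unfolding Q by (simp add: a'_def p_def mult.assoc)
  qed
  show "M = B \<circ> inv (\<lambda>v. v - (a * inverse q) *s \<psi> v)"
  proof (rule eq_comp_inv[OF \<open>bij M\<close> \<open>bij B\<close>], rule eq_if_N)
    fix w
    have "N (N w) - (a * p) *s N (K w - B w) = (a - a') *s B (N w) + a *s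
      (((1 - p) * a) *s K (K w) - (a' - p * a) *s K (B w) - (a - p * a') *s B (K w)
        + ((1 - p) * a') *s B (B w))"
      by (simp add: N_def K B algebra_simps)
    then show "N (N w) - (a * inverse q * inverse q) *s N (K w - B w) = (a - a') *s B (N w)"
      unfolding Q by (simp add: p_def mult.assoc)
  qed
qed

section \<open>From TD systems to tridiagonal systems\<close>

lemma primitive_idempotents_decomposition:
  assumes linear_f: "Vector_Spaces.linear scale scale f" and linear_g: "Vector_Spaces.linear scale scale g"
    and "diagonalizable f"
    and idem: "\<And>i. i \<le> d \<Longrightarrow> primitive_idempotent f (range (E i)) (E i)"
    and ordering: "standard_ordering f g d (\<lambda>i. range (E i))"
    and eigen: "\<And>i. i \<le> d \<Longrightarrow> range (E i) = eigenspace f (\<theta> i)"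
  shows "tridiagonal_decomposition scale Basis f g E \<theta> d"
proof -
  have linear_E: "Vector_Spaces.linear scale scale (E i)" if "i \<le> d" for i
    using idem[OF that] by (simp add: primitive_idempotent_def)
  have bij: "bij_betw (\<lambda>i. range (E i)) {..d} (eigenspaces f)"
    using ordering by (simp add: standard_ordering_def)
  have E_E: "E i (E j v) = (if i = j then E j v else 0)" if "i \<le> d" "j \<le> d" for i j v
  proof (cases "i = j")
    case True
    then show ?thesis
      using idem[OF \<open>i \<le> d\<close>] by (simp add: primitive_idempotent_def)
  next
    case False
    then have "range (E j) \<noteq> range (E i)"
      using bij that by (auto simp: bij_betw_def dest: inj_onD)
    moreover have "range (E j) \<in> eigenspaces f"
      using idem[OF \<open>j \<le> d\<close>] by (simp add: primitive_idempotent_def)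
    ultimately have "\<forall>w\<in>range (E j). E i w = 0"
      using idem[OF \<open>i \<le> d\<close>] unfolding primitive_idempotent_def by blast
    then show ?thesis
      using False by simp
  qed
  \<comment> \<open>By diagonalizability it suffices to check spanning eigenvectors. A nonzero one
    lies in some \<open>range (E i)\<close>, since the ordering exhausts the eigenspaces.\<close>
  have sum_E: "(\<Sum>i\<le>d. E i v) = v" for v
  proof -
    obtain S where S: "span S = UNIV" "\<And>v. v \<in> S \<Longrightarrow> \<exists>t. f v = t *s v"
      using \<open>diagonalizable f\<close> unfolding diagonalizable_def by blast
    let ?P = "{v. (\<Sum>i\<le>d. E i v) = v}"
    have "subspace ?P"
      using linear_E
      by (intro subspaceI) (simp_all add: linear_rules sum.distrib flip: scale_sum_right)
    moreover have "S \<subseteq> ?P"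
    proof
      fix v
      assume "v \<in> S"
      then obtain t where t: "f v = t *s v"
        using S by blast
      show "v \<in> ?P"
      proof (cases "v = 0")
        case True
        then show ?thesis
          using \<open>subspace ?P\<close> subspace_0 by blast
      next
        case False
        then have "eigenspace f t \<in> eigenspaces f"
          using t by (auto simp: eigenspaces_def eigenspace_def)
        then have "eigenspace f t \<in> (\<lambda>i. range (E i)) ` {..d}"
          using bij_betw_imp_surj_on[OF bij] by simp
        then obtain i where i: "i \<le> d" "eigenspace f t = range (E i)"
          by auto
        have "v \<in> range (E i)"
          using t by (simp add: eigenspace_def flip: i(2))
        then obtain w where w: "v = E i w"
          by blast
        have "(\<Sum>j\<le>d. E j v) = (\<Sum>j\<le>d. if j = i then v else 0)"
          using i by (intro sum.cong) (auto simp: w E_E)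
        then show ?thesis
          using i by simp
      qed
    qed
    ultimately have "span S \<subseteq> ?P"
      by (rule span_minimal[rotated])
    then show ?thesis
      using S by blast
  qed
  have E_g_E: "E j (g (E i v)) = 0" if "i \<le> d" "j \<le> d" "i + 1 < j \<or> j + 1 < i" for i j v
  proof -
    let ?X = "if i = 0 then {0} else range (E (i - 1))"
    let ?Y = "if i = d then {0} else range (E (i + 1))"
    have "g (E i v) \<in> ?X + range (E i) + ?Y"
      using ordering \<open>i \<le> d\<close> unfolding standard_ordering_def by blast
    then obtain x y z where g: "g (E i v) = x + y + z" and "x \<in> ?X" "y \<in> range (E i)" "z \<in> ?Y"
      by (elim set_plus_elim) blast
    then have "E j x = 0" "E j y = 0" "E j z = 0"
      using that linear_rules(4)[OF linear_E] by (auto simp: E_E split: if_splits)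
    then show ?thesis
      by (simp add: g linear_rules[OF linear_E[OF \<open>j \<le> d\<close>]])
  qed
  have "f (E i v) = \<theta> i *s E i v" if "i \<le> d" for i v
    using eigen[OF that] by (auto simp: eigenspace_def)
  then show ?thesis
    by (intro tridiagonal_decomposition.intro tridiagonal_decomposition_axioms.intro
        finite_dimensional_vector_space_axioms linear_f linear_g linear_E sum_E E_E E_g_E)
qed

text \<open>The second instance, with the idempotents of \<open>A\<close> reversed, is the one whose
  split map is \<open>B\<close>.\<close>

lemma TD_system_tridiagonal_system:
  assumes TD: "TD_system A E As Es d"
    and \<theta>: "\<And>i. i \<le> d \<Longrightarrow> range (E i) = eigenspace A (\<theta> i)"
    and \<theta>s: "\<And>i. i \<le> d \<Longrightarrow> range (Es i) = eigenspace As (\<theta>s i)"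
  shows "tridiagonal_system scale Basis A As E Es \<theta> \<theta>s d"
    and "tridiagonal_system scale Basis A As (\<lambda>i. E (d - i)) Es (\<lambda>i. \<theta> (d - i)) \<theta>s d"
proof -
  have P: "tridiagonal_decomposition scale Basis A As E \<theta> d"
    using TD \<theta> by (intro primitive_idempotents_decomposition) (simp_all add: TD_system_def TD_pair_def)
  have S: "tridiagonal_decomposition scale Basis As A Es \<theta>s d"
    using TD \<theta>s by (intro primitive_idempotents_decomposition) (simp_all add: TD_system_def TD_pair_def)
  have irreducible: "W = {0} \<or> W = UNIV" if "subspace W" "A ` W \<subseteq> W" "As ` W \<subseteq> W" for W
    using TD that unfolding TD_system_def TD_pair_def by blast
  have nonzero: "\<exists>v. P v \<noteq> 0" if "primitive_idempotent h (range P) P" for h P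
  proof (rule ccontr)
    assume "\<not> ?thesis"
    then have "range P = {0}"
      by auto
    then show False
      using that by (simp add: primitive_idempotent_def eigenspaces_def)
  qed
  have "\<exists>v. E i v \<noteq> 0" "\<exists>v. Es i v \<noteq> 0" if "i \<le> d" for i
    using TD that nonzero[of A "E i"] nonzero[of As "Es i"] unfolding TD_system_def by blast+
  then show "tridiagonal_system scale Basis A As E Es \<theta> \<theta>s d"
    "tridiagonal_system scale Basis A As (\<lambda>i. E (d - i)) Es (\<lambda>i. \<theta> (d - i)) \<theta>s d"
    by (intro tridiagonal_system.intro tridiagonal_system_axioms.intro P S irreducible
        tridiagonal_decomposition.reverse[OF P]; simp)+
qed

section \<open>The q-Racah case\<close>

lemma TD_system_M_map:
  assumes TD: "TD_system A E As Es d" and "d \<ge> 1" and type: "q_Racah_type A E As Es d q a b"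
  defines "K \<equiv> K_map E Es d q" and "B \<equiv> B_map E Es d q"
  defines "\<psi> \<equiv> psi_map q a K B" and "M \<equiv> M_map a K B"
  shows "M = inv (\<lambda>v. v - (inverse a * q) *s \<psi> v) \<circ> K"
    and "M = K \<circ> inv (\<lambda>v. v - (inverse a * inverse q) *s \<psi> v)"
    and "M = inv (\<lambda>v. v - (a * q) *s \<psi> v) \<circ> B"
    and "M = B \<circ> inv (\<lambda>v. v - (a * inverse q) *s \<psi> v)"
proof -
  define c where "c i = q powi (int d - 2 * int i)" for i
  define p where "p = inverse q * inverse q"
  define \<theta> where "\<theta> x i = x * c i + inverse x * inverse (c i)" for x i
  have "q \<noteq> 0" "a \<noteq> 0"
    using type by (simp_all add: q_Racah_type_def)
  then have c_nonzero: "c i \<noteq> 0" and "p \<noteq> 0" for i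
    by (simp_all add: c_def p_def)
  have c_inverse: "inverse (c i) = q powi (2 * int i - int d)" for i
    by (simp add: c_def flip: power_int_minus)
  \<comment> \<open>Reversing the order inverts \<open>c\<close>, which amounts to exchanging
    \<open>a\<close> and its inverse in \<open>\<theta> a\<close>.\<close>
  have c_reverse: "c (d - i) = inverse (c i)" if "i \<le> d" for i
    using that unfolding c_inverse by (simp add: c_def of_nat_diff)
  have c_Suc: "c (Suc i) = p * c i" for i
  proof -
    have "c (Suc i) = q powi ((int d - 2 * int i) - 2)"
      by (simp add: c_def algebra_simps)
    then show ?thesis
      using \<open>q \<noteq> 0\<close> power_int_diff[of q "int d - 2 * int i" 2]
      by (simp add: c_def p_def divide_inverse power2_eq_square)
  qed
  have E: "range (E i) = eigenspace A (\<theta> a i)" and Es: "range (Es i) = eigenspace As (\<theta> b i)"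
    if "i \<le> d" for i
    unfolding \<theta>_def c_inverse using type that by (simp_all add: q_Racah_type_def c_def)
  \<comment> \<open>Otherwise \<open>\<theta> a 0\<close> and \<open>\<theta> a d\<close> would
    coincide, although \<open>d \<ge> 1\<close> makes the two eigenspaces distinct.\<close>
  have "a \<noteq> inverse a"
  proof
    assume "a = inverse a"
    then have "range (E 0) = range (E d)"
      using c_reverse[of 0] by (simp add: E \<theta>_def add.commute)
    moreover have "inj_on (\<lambda>i. range (E i)) {..d}"
      using TD by (simp add: TD_system_def standard_ordering_def bij_betw_def)
    ultimately show False
      using \<open>d \<ge> 1\<close> by (auto dest: inj_onD)
  qed
  interpret T: tridiagonal_system scale Basis A As E Es "\<theta> a" "\<theta> b" d
    by (rule TD_system_tridiagonal_system(1)[OF TD E Es])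
  interpret R: tridiagonal_system scale Basis A As "\<lambda>i. E (d - i)" Es "\<lambda>i. \<theta> a (d - i)" "\<theta> b" d
    by (rule TD_system_tridiagonal_system(2)[OF TD E Es])
  have K: "K = T.split_map c"
    by (simp add: K_def K_map_def T.split_map_def split_U_def T.split_eq_U c_def)
  have "split_U_down E Es d i = R.U i" if "i \<le> d" for i
  proof -
    have "(\<Sum>j\<in>{i..d}. range (E (d - j))) = (\<Sum>j\<in>{0..d - i}. range (E j))"
      using that by (intro sum.reindex_bij_witness[of _ "\<lambda>j. d - j" "\<lambda>j. d - j"]) auto
    then show ?thesis
      using R.split_eq_U[OF that] by (simp add: split_U_down_def)
  qed
  then have B: "B = R.split_map c"
    by (simp add: B_def B_map_def R.split_map_def c_def)
  note linear = T.linear_split_map[of c, folded K] R.linear_split_map[of c, folded B]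
  have "inj (\<lambda>v. a *s K v - inverse a *s B v)"
  proof (rule T.S.inj_if_triangular)
    show "Vector_Spaces.linear scale scale (\<lambda>v. a *s K v - inverse a *s B v)"
      by unfold_locales
        (simp_all add: linear_rules[OF linear(1)] linear_rules[OF linear(2)]
          scale_right_distrib scale_right_diff_distrib mult_ac)
    \<comment> \<open>Both maps have diagonal \<open>c i\<close> in the flag of \<open>Es\<close>,
      so their combination has this diagonal.\<close>
    show "(a - inverse a) * c i \<noteq> 0" for i
      using \<open>a \<noteq> inverse a\<close> c_nonzero by simp
    fix i h v
    assume h: "h \<le> d" "i \<le> h" and v: "\<And>k. k \<le> d \<Longrightarrow> i < k \<Longrightarrow> Es k v = 0"
    have "Es h (K v - c i *s v) = 0" "Es h (B v - c i *s v) = 0"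
      unfolding K B using h v by (intro T.split_map_flag R.split_map_flag; simp)+
    moreover have "a *s K v - inverse a *s B v - ((a - inverse a) * c i) *s v
      = a *s (K v - c i *s v) - inverse a *s (B v - c i *s v)"
      by (simp add: algebra_simps)
    ultimately show "Es h (a *s K v - inverse a *s B v - ((a - inverse a) * c i) *s v) = 0"
      using h by (simp only: T.S.E_diff T.S.E_scale) simp
  qed
  moreover have "((1 - p) * a) *s K (K v) - (inverse a - p * a) *s K (B v)
      - (a - p * inverse a) *s B (K v) + ((1 - p) * inverse a) *s B (B v) = 0" for v
  proof -
    obtain w where w: "Es 0 w \<noteq> 0"
      using T.Es_0_nonzero by blast
    \<comment> \<open>\<open>U 0\<close> is described by \<open>Es\<close> alone, so both systems
      share it.\<close>
    have "Es 0 w \<in> T.U 0" "Es 0 w \<in> R.U 0"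
      by (simp_all add: T.U_0 R.U_0 T.S.E_E)
    then have w_eigen: "K (Es 0 w) = c 0 *s Es 0 w" "B (Es 0 w) = c 0 *s Es 0 w"
      unfolding K B by (simp_all only: T.split_map_U R.split_map_U)
    have \<theta>_c: "\<theta> x i * c i = x * (c i * c i) + inverse x" for x i
      using c_nonzero by (simp add: \<theta>_def field_simps)
    \<comment> \<open>In the reversed system \<open>x\<close> and \<open>y\<close> of
      \<open>A_split_map\<close> trade places.\<close>
    have \<theta>_c_reverse: "\<theta> a (d - i) * c i = inverse a * (c i * c i) + a" if "i \<le> d" for i
      using c_nonzero[of i] that by (simp add: \<theta>_def c_reverse field_simps)
    note relations =
      T.A_split_map[of c p, OF c_Suc \<theta>_c, folded K] R.A_split_map[of c p, OF c_Suc \<theta>_c_reverse, folded B]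
      T.As_split_map[of c p, OF c_Suc \<theta>_c, folded K] R.As_split_map[of c p, OF c_Suc \<theta>_c, folded B]
    show ?thesis
      by (rule quadratic_relation[OF T.linear_f T.linear_g linear T.irreducible relations
            \<open>p \<noteq> 0\<close> \<open>a \<noteq> inverse a\<close> w w_eigen])
  qed
  ultimately show "M = inv (\<lambda>v. v - (inverse a * q) *s \<psi> v) \<circ> K"
    "M = K \<circ> inv (\<lambda>v. v - (inverse a * inverse q) *s \<psi> v)"
    "M = inv (\<lambda>v. v - (a * q) *s \<psi> v) \<circ> B"
    "M = B \<circ> inv (\<lambda>v. v - (a * inverse q) *s \<psi> v)"
    unfolding M_def \<psi>_def p_def
    using linear c_nonzero \<open>q \<noteq> 0\<close> \<open>a \<noteq> inverse a\<close>
    by (intro M_map_formulas; simp add: K B T.bij_split_map R.bij_split_map)+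
qed

end

theorem lemma6p2:
  fixes scale :: "'k::alg_closed_field \<Rightarrow> 'v::ab_group_add \<Rightarrow> 'v"
    and Basis :: "'v set"
    and A As :: "'v \<Rightarrow> 'v" and E Es :: "nat \<Rightarrow> 'v \<Rightarrow> 'v"
    and d :: nat and q a b :: 'k
    and K B \<psi> M :: "'v \<Rightarrow> 'v"
  assumes "nonzero_fd_vector_space scale Basis"
    and "nonzero_fd_vector_space.TD_system scale A E As Es d"
    and "d \<ge> 1"
    and "nonzero_fd_vector_space.q_Racah_type scale A E As Es d q a b"
    and "K = nonzero_fd_vector_space.K_map scale E Es d q"
    and "B = nonzero_fd_vector_space.B_map scale E Es d q"
    and "\<psi> = nonzero_fd_vector_space.psi_map scale q a K B"
    and "M = nonzero_fd_vector_space.M_map scale a K B"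
  shows "M = inv (\<lambda>v. v - scale (inverse a * q) (\<psi> v)) \<circ> K
    \<and> M = K \<circ> inv (\<lambda>v. v - scale (inverse a * inverse q) (\<psi> v))
    \<and> M = inv (\<lambda>v. v - scale (a * q) (\<psi> v)) \<circ> B
    \<and> M = B \<circ> inv (\<lambda>v. v - scale (a * inverse q) (\<psi> v))"
  using nonzero_fd_vector_space.TD_system_M_map[OF assms(1-4)] unfolding assms(5-8) by blast

end
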